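(* Let $G$ be a $2$-acyclic Cayley graph with generator set $E$, and let $n\geq 3$. If the dual hypergraph $d(G)$ is an $n$-acyclic hypergraph, then the Cayley graph $G$ is $n$-acyclic.
   Context: A Cayley group is a group $G$ (finite or infinite) with a generating set $E\subseteq G$ of non-trivial involutions ($e\neq 1$, $e^2=1$ for $e\in E$). Its Cayley graph, also denoted $G$, has vertex set $G$ and $e$-labelled edges $\{v,ve\}$ for $v\in G$, $e\in E$. For $\alpha\subseteq E$, $G_\alpha$ is the subgroup generated by $\alpha$, and $[v]_\alpha=vG_\alpha$ is the $\alpha$-coset of $v$. A coset cycle of length $m$ in $G$ is a sequence $((v_i,\alpha_i))_{i\in\mathbb{Z}_m}$ with $v_i\in G$, $\alpha_i\subseteq E$, such that for all $i\in\mathbb{Z}_m$: $v_i^{-1}v_{i+1}\in G_{\alpha_i}$ and $[v_i]_{\alpha_{i-1}\cap\alpha_i}\cap[v_{i+1}]_{\alpha_i\cap\alpha_{i+1}}=\emptyset$. A Cayley graph is $n$-acyclic if it has no coset cycle of length at most $n$. A hypergraph is a pair $(A,S)$ with $S\subseteq\mathcal{P}(A)$. Its Gaifman graph is the undirected graph on $A$ linking distinct $a,a'$ whenever $a,a'\in s$ for some $s\in S$. For $n\geq 3$ the hypergraph is $n$-acyclic if it is (i) $n$-conformal: every clique of size at most $n$ in the Gaifman graph is contained in some hyperedge $s\in S$; and (ii) $n$-chordal: every cycle in the Gaifman graph of length greater than $3$ and at most $n$ has a chord, i.e. an edge between two vertices that are not neighbours along the cycle. The dual hypergraph $d(G)$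 has as vertex set the disjoint union over all $\alpha\subseteq E$ of the sets $Q_\alpha=\{[v]_\alpha: v\in G\}$ (the vertices in $Q_\alpha$ being coloured by $\alpha$), and as hyperedges the sets $[\![v]\!]=\{[v]_\alpha:\alpha\subseteq E\}$ for $v\in G$. *)

theory Defs
  imports "HOL-Algebra.Algebra"
begin

locale cayley_group = group G for G (structure) +
  fixes E :: "'a set"
  assumes generators_subset: "E \<subseteq> carrier G"
    and generators_generate: "generate G E = carrier G"
    and generators_nontrivial: "e \<in> E \<Longrightarrow> e \<noteq> \<one>"
    and generators_involutive: "e \<in> E \<Longrightarrow> e \<otimes> e = \<one>"

definition gcoset :: "('a, 'b) monoid_scheme \<Rightarrow> 'a \<Rightarrow> 'a set \<Rightarrow> 'a set" where
  "gcoset G v \<alpha> = v <#\<^bsub>G\<^esub> generate G \<alpha>"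

text \<open>
  Indices range over \<open>{..<m}\<close>, representing the residues modulo \<open>m\<close>; the successor and
  predecessor of \<open>i\<close> are \<open>(i + 1) mod m\<close> and \<open>(i + m - 1) mod m\<close>. The length is
  required to be positive, as otherwise the empty sequence would be a coset cycle.
\<close>

definition coset_cycle ::
    "('a, 'b) monoid_scheme \<Rightarrow> 'a set \<Rightarrow> nat \<Rightarrow> (nat \<Rightarrow> 'a) \<Rightarrow> (nat \<Rightarrow> 'a set) \<Rightarrow> bool" where
  "coset_cycle G E m v \<alpha> \<longleftrightarrow> 0 < m \<and>
     (\<forall>i<m. v i \<in> carrier G \<and> \<alpha> i \<subseteq> E) \<and>
     (\<forall>i<m. inv\<^bsub>G\<^esub> (v i) \<otimes>\<^bsub>G\<^esub> v ((i + 1) mod m) \<in> generate G (\<alpha> i) \<and>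
        gcoset G (v i) (\<alpha> ((i + m - 1) mod m) \<inter> \<alpha> i) \<inter>
        gcoset G (v ((i + 1) mod m)) (\<alpha> i \<inter> \<alpha> ((i + 1) mod m)) = {})"

definition cayley_acyclic :: "('a, 'b) monoid_scheme \<Rightarrow> 'a set \<Rightarrow> nat \<Rightarrow> bool" where
  "cayley_acyclic G E n \<longleftrightarrow> \<not> (\<exists>m\<le>n. \<exists>v \<alpha>. coset_cycle G E m v \<alpha>)"

type_synonym 'v hgraph = "'v set \<times> 'v set set"

definition hypergraph :: "'v hgraph \<Rightarrow> bool" where
  "hypergraph H \<longleftrightarrow> snd H \<subseteq> Pow (fst H)"

definition gaifman_adj :: "'v hgraph \<Rightarrow> 'v \<Rightarrow> 'v \<Rightarrow> bool" where
  "gaifman_adj H a b \<longleftrightarrow>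
     a \<in> fst H \<and> b \<in> fst H \<and> a \<noteq> b \<and> (\<exists>s\<in>snd H. a \<in> s \<and> b \<in> s)"

definition gaifman_clique :: "'v hgraph \<Rightarrow> 'v set \<Rightarrow> bool" where
  "gaifman_clique H K \<longleftrightarrow>
     K \<subseteq> fst H \<and> (\<forall>a\<in>K. \<forall>b\<in>K. a \<noteq> b \<longrightarrow> gaifman_adj H a b)"

definition conformal :: "nat \<Rightarrow> 'v hgraph \<Rightarrow> bool" where
  "conformal n H \<longleftrightarrow>
     (\<forall>K. gaifman_clique H K \<and> finite K \<and> card K \<le> n \<longrightarrow> (\<exists>s\<in>snd H. K \<subseteq> s))"

definition gaifman_cycle :: "'v hgraph \<Rightarrow> nat \<Rightarrow> (nat \<Rightarrow> 'v) \<Rightarrow> bool" where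
  "gaifman_cycle H m c \<longleftrightarrow> 3 \<le> m \<and> inj_on c {..<m} \<and>
     (\<forall>i<m. c i \<in> fst H \<and> gaifman_adj H (c i) (c ((i + 1) mod m)))"

definition has_chord :: "'v hgraph \<Rightarrow> nat \<Rightarrow> (nat \<Rightarrow> 'v) \<Rightarrow> bool" where
  "has_chord H m c \<longleftrightarrow>
     (\<exists>i<m. \<exists>j<m. j \<noteq> (i + 1) mod m \<and> i \<noteq> (j + 1) mod m \<and> gaifman_adj H (c i) (c j))"

definition chordal :: "nat \<Rightarrow> 'v hgraph \<Rightarrow> bool" where
  "chordal n H \<longleftrightarrow> (\<forall>m c. 3 < m \<and> m \<le> n \<and> gaifman_cycle H m c \<longrightarrow> has_chord H m c)"

definition acyclic_hypergraph :: "nat \<Rightarrow> 'v hgraph \<Rightarrow> bool" where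
  "acyclic_hypergraph n H \<longleftrightarrow> hypergraph H \<and> conformal n H \<and> chordal n H"

text \<open>
  A vertex is a pair of a colour \<open>\<alpha>\<close> and an \<open>\<alpha>\<close>-coset. The colour makes the union of
  the sets of \<open>\<alpha>\<close>-cosets disjoint: different \<open>\<alpha>\<close> may a priori generate the same subgroup.
\<close>

definition dual_hyperedge ::
    "('a, 'b) monoid_scheme \<Rightarrow> 'a set \<Rightarrow> 'a \<Rightarrow> ('a set \<times> 'a set) set" where
  "dual_hyperedge G E v = {(\<alpha>, gcoset G v \<alpha>) | \<alpha>. \<alpha> \<subseteq> E}"

definition dual_hypergraph ::
    "('a, 'b) monoid_scheme \<Rightarrow> 'a set \<Rightarrow> ('a set \<times> 'a set) hgraph" where
  "dual_hypergraph G E =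
     ({(\<alpha>, gcoset G v \<alpha>) | \<alpha> v. \<alpha> \<subseteq> E \<and> v \<in> carrier G}, dual_hyperedge G E ` carrier G)"

lemma hypergraph_dual_hypergraph: "hypergraph (dual_hypergraph G E)"
  by (auto simp: hypergraph_def dual_hypergraph_def dual_hyperedge_def)

end

theory Submission
  imports Defs
begin

text \<open>
  A coset cycle \<open>(v\<^sub>i, \<alpha>\<^sub>i)\<close> gives the vertices \<open>c\<^sub>i = [v\<^sub>i]\<close> of colour \<open>\<alpha>\<^sub>i\<close> in the dual
  hypergraph. Consecutive ones share a hyperedge because \<open>v\<^sub>i\<^sub>+\<^sub>1\<close> lies in both cosets, and
  since 2-acyclicity identifies \<open>[v]\<^sub>\<alpha> \<inter> [v]\<^sub>\<beta>\<close> with the \<open>(\<alpha> \<inter> \<beta>)\<close>-coset of \<open>v\<close>, no hyperedge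
  contains three consecutive ones. In an acyclic hypergraph, the ends of such a sequence never share
  a hyperedge: a shortest counterexample would be a triangle violating conformality or a
  chordless cycle. But \<open>v\<^sub>0\<close> lies in both the first and the last coset.
\<close>

lemma gaifman_adj_iff:
  assumes "hypergraph H"
  shows "gaifman_adj H a b \<longleftrightarrow> a \<noteq> b \<and> (\<exists>s\<in>snd H. a \<in> s \<and> b \<in> s)"
  using assms unfolding gaifman_adj_def hypergraph_def by blast

text \<open>Strong induction on \<open>k\<close>, so that every shorter stretch of the path already
  satisfies the claim. The bound \<open>k < n\<close> ensures that the path closed up by an edge
  between its ends, having \<open>k + 1\<close> vertices, is short enough for chordality.\<close>

lemma acyclic_hypergraph_path_ends:
  assumes H: "acyclic_hypergraph n H" "3 \<le> n"
    and "2 \<le> k" "k < n"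
    and "\<And>i. i < k \<Longrightarrow> \<exists>s\<in>snd H. c i \<in> s \<and> c (i + 1) \<in> s"
    and "\<And>i. i + 2 \<le> k \<Longrightarrow> \<not> (\<exists>s\<in>snd H. c i \<in> s \<and> c (i + 1) \<in> s \<and> c (i + 2) \<in> s)"
  shows "\<not> (\<exists>s\<in>snd H. c 0 \<in> s \<and> c k \<in> s)"
  using assms(3-)
proof (induction k arbitrary: c rule: less_induct)
  case (less k)
  note step = less.prems(3) and triple = less.prems(4)
  have hyp: "hypergraph H" and conf: "conformal n H" and chord: "chordal n H"
    using H by (auto simp: acyclic_hypergraph_def)
  note adj = gaifman_adj_iff[OF hyp]
  \<comment> \<open>The induction hypothesis for the stretch from \<open>i\<close> to
    \<open>j\<close>, reindexed to start at 0; \<open>j - i < k\<close> leaves out only the two ends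
    of the whole path.\<close>
  have far: "\<not> (\<exists>s\<in>snd H. c i \<in> s \<and> c j \<in> s)"
    if "i + 2 \<le> j" "j \<le> k" "j - i < k" for i j
  proof -
    have "\<not> (\<exists>s\<in>snd H. c (i + 0) \<in> s \<and> c (i + (j - i)) \<in> s)"
    proof (rule less.IH[where c = "\<lambda>l. c (i + l)"])
      show "\<exists>s\<in>snd H. c (i + l) \<in> s \<and> c (i + (l + 1)) \<in> s" if "l < j - i" for l
        using step[of "i + l"] that \<open>j \<le> k\<close> by (simp add: add.assoc)
      show "\<not> (\<exists>s\<in>snd H. c (i + l) \<in> s \<and> c (i + (l + 1)) \<in> s \<and> c (i + (l + 2)) \<in> s)"
        if "l + 2 \<le> j - i" for l
        using triple[of "i + l"] that \<open>j \<le> k\<close> \<open>i + 2 \<le> j\<close> by (simp add: add.assoc)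
    qed (use that less.prems(2) in auto)
    then show ?thesis using that by simp
  qed
  \<comment> \<open>If two neighbours coincide, a hyperedge of an adjacent step contains three
    consecutive vertices. That step is the following one, or the preceding one when \<open>i\<close>
    is the last step.\<close>
  have next_ne: "c i \<noteq> c (i + 1)" if "i < k" for i
  proof
    assume eq: "c i = c (i + 1)"
    show False
    proof (cases "i + 2 \<le> k")
      case True
      then have "\<exists>s\<in>snd H. c (i + 1) \<in> s \<and> c (i + 2) \<in> s" using step[of "i + 1"] by simp
      then show False using triple[OF True] eq by metis
    next
      case False
      with that less.prems(1) have "i = (i - 1) + 1" "(i - 1) + 2 \<le> k" by auto
      then obtain l where "i = l + 1" "l + 2 \<le> k" by blast
      then have "\<exists>s\<in>snd H. c l \<in> s \<and> c (l + 1) \<in> s" "c (l + 1) = c (l + 2)"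
        using step[of l] eq by simp_all
      then show False using triple[OF \<open>l + 2 \<le> k\<close>] by metis
    qed
  qed
  show ?case
  proof
    assume ends: "\<exists>s\<in>snd H. c 0 \<in> s \<and> c k \<in> s"
    show False
    proof (cases "k = 2")
      case True
      have pairs: "\<exists>s\<in>snd H. c 0 \<in> s \<and> c 1 \<in> s" "\<exists>s\<in>snd H. c 1 \<in> s \<and> c 2 \<in> s"
          "\<exists>s\<in>snd H. c 0 \<in> s \<and> c 2 \<in> s"
        using step[of 0] step[of 1] ends unfolding True by (simp_all add: numeral_2_eq_2)
      then have "gaifman_adj H a b" if "a \<in> {c 0, c 1, c 2}" "b \<in> {c 0, c 1, c 2}" "a \<noteq> b" for a b
        using that unfolding adj by auto
      moreover have "{c 0, c 1, c 2} \<subseteq> fst H"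
        using pairs hyp unfolding hypergraph_def by blast
      ultimately have "gaifman_clique H {c 0, c 1, c 2}"
        unfolding gaifman_clique_def by blast
      \<comment> \<open>Conformality concerns sets of vertices, so an upper bound suffices and
        distinctness need not be checked.\<close>
      moreover have "card {c 0, c 1, c 2} \<le> n"
        using \<open>3 \<le> n\<close> card_length[of "[c 0, c 1, c 2]"] by simp
      ultimately have "\<exists>s\<in>snd H. {c 0, c 1, c 2} \<subseteq> s"
        using conf[unfolded conformal_def, rule_format, of "{c 0, c 1, c 2}"] by simp
      then show False using triple[of 0] unfolding True add_0 by blast
    next
      case False
      with less.prems(1) have k: "3 \<le> k" by linarith
      \<comment> \<open>Replacing \<open>c j\<close> by the equal \<open>c i\<close> makes a
        neighbour edge join two vertices that \<open>far\<close> separates. For the two ends this is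
        the edge at \<open>k - 1\<close>, and \<open>far\<close> applies to \<open>0\<close> and
        \<open>k - 1\<close> because \<open>k\<close> is at least 3.\<close>
      have ne: "c i \<noteq> c j" if "i < j" "j \<le> k" for i j
      proof
        assume eq: "c i = c j"
        have "j = i + 1 \<or> i = 0 \<and> j = k \<or> i + 2 \<le> j \<and> j - i < k"
          using that by arith
        then consider "j = i + 1" | "i = 0" "j = k" | "i + 2 \<le> j" "j - i < k"
          by blast
        then show False
        proof cases
          case 1
          then show False using next_ne[of i] eq that by simp
        next
          case 2
          then show False using step[of "k - 1"] far[of 0 "k - 1"] eq k by auto
        next
          case 3
          then show False using step[of i] far[of i j] eq that by auto
        qed
      qed
      have "gaifman_cycle H (k + 1) c"
        unfolding gaifman_cycle_def
      proof (intro conjI allI impI)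
        show "inj_on c {..<k + 1}"
          by (rule linorder_inj_onI') (use ne in auto)
        fix i assume i: "i < k + 1"
        show "gaifman_adj H (c i) (c ((i + 1) mod (k + 1)))"
        proof (cases "i = k")
          case True
          then show ?thesis using ends ne[of 0 k] k unfolding adj by auto
        next
          case False
          then show ?thesis using i step[of i] ne[of i "i + 1"] unfolding adj by auto
        qed
        then show "c i \<in> fst H" by (simp add: gaifman_adj_def)
      qed (use k in simp)
      then have "has_chord H (k + 1) c"
        using chord k less.prems(2) unfolding chordal_def by auto
      then obtain i j where ij: "i \<le> k" "j \<le> k" "j \<noteq> (i + 1) mod (k + 1)"
          "i \<noteq> (j + 1) mod (k + 1)" and a: "gaifman_adj H (c i) (c j)"
        unfolding has_chord_def by (auto simp: less_Suc_eq_le)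
      \<comment> \<open>Excluding cyclic neighbours rules out both \<open>j = i + 1\<close> and the
        pair of ends, so exactly the pairs covered by \<open>far\<close> remain. Symmetry of
        adjacency then allows assuming \<open>i < j\<close>.\<close>
      have no: False
        if "i < j" "j \<le> k" "j \<noteq> (i + 1) mod (k + 1)" "i \<noteq> (j + 1) mod (k + 1)"
          "gaifman_adj H (c i) (c j)" for i j
      proof -
        have "j \<noteq> i + 1" using that(2,3) by auto
        moreover have "\<not> (i = 0 \<and> j = k)" using that(4) by auto
        ultimately have "i + 2 \<le> j" "j - i < k" using that(1,2) by linarith+
        then show False using far[of i j] that(2,5) unfolding adj by blast
      qed
      have "i \<noteq> j" using a unfolding adj by blast
      moreover have "gaifman_adj H (c j) (c i)" using a unfolding adj by auto
      ultimately show False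
        using no[of i j] no[of j i] ij a by (meson linorder_neqE_nat)
    qed
  qed
qed

context cayley_group
begin

lemma subgroup_generate: "\<alpha> \<subseteq> E \<Longrightarrow> subgroup (generate G \<alpha>) G"
  using generators_subset generate_is_subgroup by auto

lemma mem_gcoset_iff:
  assumes "v \<in> carrier G" "\<alpha> \<subseteq> E"
  shows "x \<in> gcoset G v \<alpha> \<longleftrightarrow> x \<in> carrier G \<and> inv v \<otimes> x \<in> generate G \<alpha>"
proof -
  interpret S: subgroup "generate G \<alpha>" G by (rule subgroup_generate[OF assms(2)])
  show ?thesis
  proof
    assume "x \<in> gcoset G v \<alpha>"
    then show "x \<in> carrier G \<and> inv v \<otimes> x \<in> generate G \<alpha>"
      using assms(1) by (auto simp: gcoset_def l_coset_def m_assoc[symmetric])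
  next
    assume x: "x \<in> carrier G \<and> inv v \<otimes> x \<in> generate G \<alpha>"
    then have "x = v \<otimes> (inv v \<otimes> x)" using assms(1) by (simp add: m_assoc[symmetric])
    with x show "x \<in> gcoset G v \<alpha>" unfolding gcoset_def l_coset_def by blast
  qed
qed

lemma self_mem_gcoset: "v \<in> carrier G \<Longrightarrow> \<alpha> \<subseteq> E \<Longrightarrow> v \<in> gcoset G v \<alpha>"
  by (simp add: mem_gcoset_iff generate.one)

lemma gcoset_eqI:
  assumes "v \<in> carrier G" "\<alpha> \<subseteq> E" "x \<in> gcoset G v \<alpha>"
  shows "gcoset G x \<alpha> = gcoset G v \<alpha>"
  using l_repr_independence[OF _ assms(1) subgroup_generate[OF assms(2)]] assms(3)
  by (simp add: gcoset_def)

text \<open>A point \<open>x\<close> violating the inclusion would yield the coset cycle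
  \<open>(v, \<alpha>)\<close>, \<open>(x, \<beta>)\<close> of length 2.\<close>

lemma gcoset_Int:
  assumes acyc: "cayley_acyclic G E 2"
    and v: "v \<in> carrier G" and \<alpha>: "\<alpha> \<subseteq> E" and \<beta>: "\<beta> \<subseteq> E"
  shows "gcoset G v \<alpha> \<inter> gcoset G v \<beta> \<subseteq> gcoset G v (\<alpha> \<inter> \<beta>)"
proof
  fix x assume x: "x \<in> gcoset G v \<alpha> \<inter> gcoset G v \<beta>"
  have xc: "x \<in> carrier G" using x v \<alpha> by (simp add: mem_gcoset_iff)
  have int: "\<alpha> \<inter> \<beta> \<subseteq> E" using \<alpha> by blast
  show "x \<in> gcoset G v (\<alpha> \<inter> \<beta>)"
  proof (rule ccontr)
    assume nx: "x \<notin> gcoset G v (\<alpha> \<inter> \<beta>)"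
    \<comment> \<open>In length 2 the predecessor and the successor of an index agree, so this
      single disjointness serves both indices.\<close>
    have disj: "gcoset G v (\<alpha> \<inter> \<beta>) \<inter> gcoset G x (\<alpha> \<inter> \<beta>) = {}"
    proof (rule ccontr)
      assume "gcoset G v (\<alpha> \<inter> \<beta>) \<inter> gcoset G x (\<alpha> \<inter> \<beta>) \<noteq> {}"
      then obtain y where "y \<in> gcoset G v (\<alpha> \<inter> \<beta>)" "y \<in> gcoset G x (\<alpha> \<inter> \<beta>)" by blast
      then have "gcoset G x (\<alpha> \<inter> \<beta>) = gcoset G v (\<alpha> \<inter> \<beta>)"
        using gcoset_eqI v xc int by metis
      then show False using nx self_mem_gcoset[OF xc int] by blast
    qed
    have "v \<in> gcoset G x \<beta>"
      using x gcoset_eqI[OF v \<beta>] self_mem_gcoset[OF v \<beta>] by blast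
    then have "coset_cycle G E 2 (\<lambda>i. if i = 0 then v else x) (\<lambda>i. if i = 0 then \<alpha> else \<beta>)"
      using x v xc \<alpha> \<beta> disj
      by (auto simp: coset_cycle_def less_2_cases_iff mem_gcoset_iff Int_commute)
    then show False using acyc unfolding cayley_acyclic_def by blast
  qed
qed

text \<open>The colour leaves the \<open>\<alpha>\<close>-coset of \<open>x\<close> as the only
  candidate in the hyperedge, and cosets of one subgroup partition the group.\<close>

lemma dual_edge_iff:
  assumes "v \<in> carrier G" "\<alpha> \<subseteq> E" "x \<in> carrier G"
  shows "(\<alpha>, gcoset G v \<alpha>) \<in> dual_hyperedge G E x \<longleftrightarrow> x \<in> gcoset G v \<alpha>"
proof -
  have "(\<alpha>, gcoset G v \<alpha>) \<in> dual_hyperedge G E x \<longleftrightarrow> gcoset G x \<alpha> = gcoset G v \<alpha>"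
    using assms(2) by (auto simp: dual_hyperedge_def)
  then show ?thesis
    using gcoset_eqI[OF assms(1,2)] self_mem_gcoset[OF assms(3,2)] by blast
qed

end

theorem lemma3p19:
  fixes G :: "('a, 'b) monoid_scheme" and E :: "'a set" and n :: nat
  assumes "cayley_group G E"
    and "cayley_acyclic G E 2"
    and "3 \<le> n"
    and "acyclic_hypergraph n (dual_hypergraph G E)"
  shows "cayley_acyclic G E n"
  unfolding cayley_acyclic_def
proof clarify
  fix m v \<alpha>
  assume m: "m \<le> n" and cyc: "coset_cycle G E m v \<alpha>"
  interpret cayley_group G E by fact
  \<comment> \<open>This gives the path \<open>c 0\<close>, ..., \<open>c (m - 1)\<close> the three
    vertices that the path lemma requires.\<close>
  have "2 < m"
    using assms(2) cyc unfolding cayley_acyclic_def by (meson not_le)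
  have v: "v i \<in> carrier G" and \<alpha>: "\<alpha> i \<subseteq> E" if "i < m" for i
    using cyc that by (auto simp: coset_cycle_def)
  have succ: "v ((i + 1) mod m) \<in> gcoset G (v i) (\<alpha> i)" if "i < m" for i
    using cyc that by (simp add: coset_cycle_def mem_gcoset_iff)
  define c where "c i = (\<alpha> i, gcoset G (v i) (\<alpha> i))" for i
  have edge: "dual_hyperedge G E x \<in> snd (dual_hypergraph G E)" if "x \<in> carrier G" for x
    using that by (simp add: dual_hypergraph_def)
  have c: "c i \<in> dual_hyperedge G E x \<longleftrightarrow> x \<in> gcoset G (v i) (\<alpha> i)"
    if "i < m" "x \<in> carrier G" for i x
    using that v \<alpha> by (simp add: c_def dual_edge_iff)
  have c_self: "c i \<in> dual_hyperedge G E (v i)" if "i < m" for i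
    using that by (simp add: c v \<alpha> self_mem_gcoset)
  have c_succ: "c i \<in> dual_hyperedge G E (v ((i + 1) mod m))" if "i < m" for i
    using that succ v by (simp add: c)
  \<comment> \<open>The cycle is cut open between \<open>m - 1\<close> and \<open>0\<close>, so that
    no index wraps around in the premises below.\<close>
  have "\<not> (\<exists>s\<in>snd (dual_hypergraph G E). c 0 \<in> s \<and> c (m - 1) \<in> s)"
  proof (rule acyclic_hypergraph_path_ends[OF assms(4,3)])
    show "\<exists>s\<in>snd (dual_hypergraph G E). c i \<in> s \<and> c (i + 1) \<in> s" if "i < m - 1" for i
    proof (intro bexI conjI)
      show "c i \<in> dual_hyperedge G E (v (i + 1))"
        using c_succ[of i] that by simp
      show "c (i + 1) \<in> dual_hyperedge G E (v (i + 1))"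
        using c_self[of "i + 1"] that by simp
      show "dual_hyperedge G E (v (i + 1)) \<in> snd (dual_hypergraph G E)"
        using edge v that by simp
    qed
    show "\<not> (\<exists>s\<in>snd (dual_hypergraph G E). c i \<in> s \<and> c (i + 1) \<in> s \<and> c (i + 2) \<in> s)"
      if "i + 2 \<le> m - 1" for i
    proof
      assume "\<exists>s\<in>snd (dual_hypergraph G E). c i \<in> s \<and> c (i + 1) \<in> s \<and> c (i + 2) \<in> s"
      then obtain x where x: "x \<in> carrier G"
        and "c i \<in> dual_hyperedge G E x" "c (i + 1) \<in> dual_hyperedge G E x"
          "c (i + 2) \<in> dual_hyperedge G E x"
        by (auto simp: dual_hypergraph_def)
      have lt: "i < m" "i + 1 < m" "i + 2 < m" using that \<open>2 < m\<close> by auto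
      have mem: "x \<in> gcoset G (v i) (\<alpha> i)" "x \<in> gcoset G (v (i + 1)) (\<alpha> (i + 1))"
          "x \<in> gcoset G (v (i + 2)) (\<alpha> (i + 2))"
        using c[OF lt(1) x] c[OF lt(2) x] c[OF lt(3) x] \<open>c i \<in> _\<close> \<open>c (i + 1) \<in> _\<close> \<open>c (i + 2) \<in> _\<close>
        by blast+
      \<comment> \<open>\<open>gcoset_Int\<close> needs a common representative: the coset of colour
        \<open>\<alpha> i\<close> is rebased at \<open>v (i + 1)\<close>, and below the one of
        colour \<open>\<alpha> (i + 1)\<close> at \<open>v (i + 2)\<close>.\<close>
      have "gcoset G (v (i + 1)) (\<alpha> i) = gcoset G (v i) (\<alpha> i)"
        using gcoset_eqI[OF v \<alpha> succ, of i] lt by simp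
      then have 1: "x \<in> gcoset G (v (i + 1)) (\<alpha> i \<inter> \<alpha> (i + 1))"
        using gcoset_Int[OF assms(2) v \<alpha> \<alpha>, of "i + 1" i "i + 1"] mem lt by auto
      have "gcoset G (v (i + 2)) (\<alpha> (i + 1)) = gcoset G (v (i + 1)) (\<alpha> (i + 1))"
        using gcoset_eqI[OF v \<alpha> succ, of "i + 1"] lt by simp
      then have 2: "x \<in> gcoset G (v (i + 2)) (\<alpha> (i + 1) \<inter> \<alpha> (i + 2))"
        using gcoset_Int[OF assms(2) v \<alpha> \<alpha>, of "i + 2" "i + 1" "i + 2"] mem lt by auto
      \<comment> \<open>The cycle condition at index \<open>i + 1\<close>, whose predecessor
        \<open>(i + 1 + m - 1) mod m\<close> is \<open>i\<close>, says that the two cosets just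
        shown to contain \<open>x\<close> are disjoint.\<close>
      have "gcoset G (v (i + 1)) (\<alpha> ((i + 1 + m - 1) mod m) \<inter> \<alpha> (i + 1)) \<inter>
          gcoset G (v ((i + 1 + 1) mod m)) (\<alpha> (i + 1) \<inter> \<alpha> ((i + 1 + 1) mod m)) = {}"
        using cyc lt(2) unfolding coset_cycle_def by blast
      then show False using 1 2 lt by auto
    qed
  qed (use m \<open>2 < m\<close> in auto)
  \<comment> \<open>The wrap-around step of the cycle: the hyperedge of \<open>v 0\<close> contains
    both ends of the path.\<close>
  moreover have "c (m - 1) \<in> dual_hyperedge G E (v 0)"
    using c_succ[of "m - 1"] \<open>2 < m\<close> by simp
  ultimately show False
    using c_self[of 0] edge[OF v[of 0]] \<open>2 < m\<close> by auto
qed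

end
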